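(* Let $p$ be a prime. Suppose $f(x)=a_{n_r}x^{n_r}+a_{n_{r-1}}x^{n_{r-1}}+\cdots+a_{n_1}x^{n_1}+p^u\epsilon\in (\mathcal{S}_1\cup \mathcal{S}_2'\cup \mathcal{S}_3')\cap \mathbb{Z}_+[x]$ and $a_{n_1}+a_{n_2}+\dots+a_{n_{r-1}}+a_{n_r}=p^u$. Then $f(x)$ is irreducible over $\mathbb{Z}$ if and only if there exist distinct $i,j\in\{1,\ldots,r\}$ such that $e(n_i)\ne e(n_j)$.
   Context: Let $p$ be a prime number. For a positive integer $n_1$, $\mathcal{S}_{n_1}$ denotes the set of all polynomials $a_{n_r}x^{n_r}+a_{n_{r-1}}x^{n_{r-1}}+\cdots+a_{n_1}x^{n_1}+p^u\epsilon\in\mathbb{Z}[x]$ (with $r\ge 1$) such that $n_r>n_{r-1}>\cdots>n_1>0$ are integers, $u\ge 2$ is an integer, $\epsilon=\pm 1$, $p\nmid a_{n_1}a_{n_r}$, and every $a_{n_i}$ is a nonzero integer. Thus $n_1$ is the smallest positive exponent occurring. Also $\mathcal{S}_{n_1}'=\{f\in\mathcal{S}_{n_1}\mid u\not\equiv 0\pmod{n_1}\}$. Membership in $\mathbb{Z}_+[x]$ means that all the nonzero coefficients (including the constant term) are positive. For a positive integer $n=2^a n'$ with $n'$ odd, $e(n)=2^a$. *)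

theory Defs
  imports "HOL-Computational_Algebra.Computational_Algebra" "HOL-Number_Theory.Cong"
begin

text \<open>The exponents \<open>n 1 < \<dots> < n r\<close> and the coefficients \<open>a 1, \<dots>, a r\<close> are functions of
  the position \<open>i \<in> {1..r}\<close> of the monomial; their values outside this range are irrelevant.\<close>

definition S_form ::
  "nat \<Rightarrow> nat \<Rightarrow> (nat \<Rightarrow> nat) \<Rightarrow> (nat \<Rightarrow> int) \<Rightarrow> nat \<Rightarrow> int \<Rightarrow> int poly \<Rightarrow> bool" where
  "S_form p r n a u \<epsilon> f \<longleftrightarrow>
     f = (\<Sum>i=1..r. monom (a i) (n i)) + [:int p ^ u * \<epsilon>:] \<and>
     1 \<le> r \<and> 0 < n 1 \<and> strict_mono_on {1..r} n \<and>
     2 \<le> u \<and> (\<epsilon> = 1 \<or> \<epsilon> = -1) \<and>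
     \<not> int p dvd a 1 * a r \<and> (\<forall>i\<in>{1..r}. a i \<noteq> 0)"

definition S :: "nat \<Rightarrow> nat \<Rightarrow> int poly set" where
  "S p m = {f. \<exists>r n a u \<epsilon>. S_form p r n a u \<epsilon> f \<and> n 1 = m}"

text \<open>For prime \<open>p\<close> the exponent \<open>u\<close> is determined by \<open>f\<close>, since the constant term of \<open>f\<close>
  has absolute value \<open>p ^ u\<close>.\<close>

definition S' :: "nat \<Rightarrow> nat \<Rightarrow> int poly set" where
  "S' p m = {f. \<exists>r n a u \<epsilon>. S_form p r n a u \<epsilon> f \<and> n 1 = m \<and> \<not> [u = 0] (mod m)}"

definition positive_polys :: "int poly set" where
  "positive_polys = {f. \<forall>k. coeff f k \<noteq> 0 \<longrightarrow> coeff f k > 0}"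

definition e :: "nat \<Rightarrow> nat" where
  "e n = 2 ^ multiplicity 2 n"

end

theory Submission imports Defs begin

text \<open>
  Write \<open>f = a\<^sub>1 x^n\<^sub>1 + \<dots> + a\<^sub>r x^n\<^sub>r + p^u\<close>. Positivity forces the sign \<open>\<epsilon>\<close> to be \<open>1\<close>, and since the
  \<open>a\<^sub>i\<close> are positive with sum \<open>p^u\<close>, the triangle inequality shows that a complex root \<open>z\<close> of \<open>f\<close>
  with \<open>\<bar>z\<bar> \<le> 1\<close> can only exist if \<open>z^n\<^sub>i = -1\<close> for every \<open>i\<close>
  (\<open>powers_eq_minus_1_if_weighted_sum_extremal\<close>). Comparing powers of two, this makes all \<open>e (n\<^sub>i)\<close>
  equal (\<open>e_eq_if_powers_eq_minus_1\<close>). Hence, as soon as two of the values \<open>e (n\<^sub>i)\<close> differ, all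
  roots of \<open>f\<close> lie strictly outside the unit disc.

  In that case let \<open>f = g h\<close>. A nonconstant factor has a constant term of absolute value greater
  than \<open>1\<close>, because this term is, up to sign, the leading coefficient times the product of the roots
  (\<open>constant_term_gt_1_if_roots_outside_unit_disc\<close>). On the other hand the lower boundary of the
  \<open>p\<close>-adic Newton polygon of \<open>f\<close> starts with a single edge from \<open>(0, u)\<close> to \<open>(n\<^sub>1, 0)\<close>. Membership
  in \<open>S\<^sub>1\<close>, \<open>S'\<^sub>2\<close> or \<open>S'\<^sub>3\<close> says that \<open>u\<close> and \<open>n\<^sub>1\<close> are coprime, so this edge contains no lattice
  points besides its ends and cannot be shared between \<open>g\<close> and \<open>h\<close>: one of the two constant terms
  is prime to \<open>p\<close> (\<open>newton_polygon_one_edge_factor\<close>). Being a divisor of \<open>p^u\<close>, it is \<open>\<plusminus>1\<close>, and the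
  corresponding factor is a unit.

  Conversely, if all \<open>e (n\<^sub>i)\<close> equal \<open>E\<close>, then each \<open>n\<^sub>i\<close> is an odd multiple of \<open>E\<close>, and \<open>x^E + 1\<close>
  divides every summand of \<open>f = a\<^sub>1 (x^n\<^sub>1 + 1) + \<dots> + a\<^sub>r (x^n\<^sub>r + 1)\<close>. The cofactor has constant term
  \<open>p^u\<close>, so it is not a unit either.
\<close>

section \<open>Factorizations and the Newton polygon\<close>

lemma last_minimum_exists:
  fixes W :: "nat \<Rightarrow> nat"
  assumes "finite A" "A \<noteq> {}"
  obtains i where "i \<in> A" "\<And>k. k \<in> A \<Longrightarrow> W i \<le> W k" "\<And>k. k \<in> A \<Longrightarrow> i < k \<Longrightarrow> W i < W k"
proof -
  define M where "M = {k \<in> A. W k = Min (W ` A)}"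
  have "Min (W ` A) \<in> W ` A"
    using assms by (intro Min_in) auto
  then obtain k where "k \<in> A" "W k = Min (W ` A)"
    by (metis imageE)
  then have M: "finite M" "M \<noteq> {}"
    using assms(1) by (auto simp: M_def)
  have min: "Max M \<in> A" "W (Max M) = Min (W ` A)"
    using Max_in[OF M] by (auto simp: M_def)
  have le: "W (Max M) \<le> W k" if "k \<in> A" for k
    unfolding min(2) using assms that by simp
  have "W (Max M) < W k" if "k \<in> A" "Max M < k" for k
  proof (rule ccontr)
    assume "\<not> ?thesis"
    then have "k \<in> M"
      using le[OF that(1)] that(1) min by (auto simp: M_def)
    then show False
      using Max_ge[OF M(1)] that(2) by fastforce
  qed
  with min(1) le show ?thesis by (intro that)
qed

text \<open>
  Put the point \<open>(k, v (q\<^sub>k))\<close> above the exponent \<open>k\<close> of a polynomial \<open>q\<close>, where \<open>v\<close> is the \<open>p\<close>-adic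
  valuation. The weight \<open>m v (q\<^sub>k) + k u\<close> is constant along lines of slope \<open>-u/m\<close>, the slope of the
  edge from \<open>(0, u)\<close> to \<open>(m, 0)\<close>. As in Gauss's lemma, the last exponents \<open>i\<close> and \<open>j\<close> of minimal
  weight in \<open>g\<close> and \<open>h\<close> yield a coefficient of \<open>g h\<close> at \<open>i + j\<close> in which nothing cancels, and this
  must be the end of the edge: \<open>i + j = m\<close>. Then the edges of \<open>g\<close> and \<open>h\<close> of this slope have
  horizontal lengths \<open>i\<close> and \<open>j\<close>. Such an edge climbs an integral height only if \<open>m\<close> divides \<open>i u\<close>,
  so by coprimality one factor takes the whole edge.
\<close>
lemma newton_polygon_one_edge_factor:
  fixes g h :: "int poly" and p :: int
  assumes p: "prime p"
    and const: "\<bar>coeff (g * h) 0\<bar> = p ^ u"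
    and gap: "\<And>k. 0 < k \<Longrightarrow> k < m \<Longrightarrow> coeff (g * h) k = 0"
    and vertex: "\<not> p dvd coeff (g * h) m"
    and cop: "coprime u m" and "0 < u" "0 < m"
  shows "\<not> p dvd coeff g 0 \<or> \<not> p dvd coeff h 0"
proof -
  define v where "v = (\<lambda>q k. multiplicity p (coeff q k))"
  define W where "W = (\<lambda>q k. m * v q k + k * u)"
  define supp where "supp = (\<lambda>q :: int poly. {k. coeff q k \<noteq> 0})"
  have pe: "prime_elem p" and p_unit: "\<not> is_unit p" and p0: "p \<noteq> 0"
    using p by auto
  have "coeff (g * h) 0 \<noteq> 0"
    using const p0 by auto
  then have g0: "coeff g 0 \<noteq> 0" and h0: "coeff h 0 \<noteq> 0"
    by (auto simp: coeff_mult)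
  have fin: "finite (supp q)" for q
    by (rule finite_subset[of _ "{..degree q}"]) (auto simp: supp_def le_degree)
  have v0: "v g 0 + v h 0 = u"
  proof -
    have "multiplicity p (coeff (g * h) 0) = multiplicity p \<bar>coeff (g * h) 0\<bar>"
      by (metis multiplicity_normalize_right normalize_int_def)
    also have "\<dots> = u"
      unfolding const using p0 p_unit by (rule multiplicity_same_power)
    finally show ?thesis
      using prime_elem_multiplicity_mult_distrib[OF pe g0 h0] by (simp add: v_def coeff_mult_0)
  qed
  obtain i where i: "i \<in> supp g" "\<And>k. k \<in> supp g \<Longrightarrow> W g i \<le> W g k"
      "\<And>k. k \<in> supp g \<Longrightarrow> i < k \<Longrightarrow> W g i < W g k"
    using last_minimum_exists[of "supp g" "W g"] fin g0 unfolding supp_def by blast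
  obtain j where j: "j \<in> supp h" "\<And>k. k \<in> supp h \<Longrightarrow> W h j \<le> W h k"
      "\<And>k. k \<in> supp h \<Longrightarrow> j < k \<Longrightarrow> W h j < W h k"
    using last_minimum_exists[of "supp h" "W h"] fin h0 unfolding supp_def by blast
  have le0: "W g i \<le> m * v g 0" "W h j \<le> m * v h 0"
    using i(2)[of 0] j(2)[of 0] g0 h0 by (auto simp: supp_def W_def)
  have mu: "m * v g 0 + m * v h 0 = m * u"
    using v0 by (metis distrib_left)
  (* W g k + W h l exceeds m times the valuation of the product by (k + l) u, so the hypothesis
     puts this valuation above s - 1. It only has to hold where neither coefficient vanishes,
     because the multiplicity of p in 0 is 0. *)
  have term_dvd: "p ^ s dvd coeff g k * coeff h l"
    if "k \<in> supp g \<Longrightarrow> l \<in> supp h \<Longrightarrow> m * s + (k + l) * u < W g k + W h l + m" for k l s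
  proof (cases "k \<in> supp g \<and> l \<in> supp h")
    case True
    then have "m * s < m * (v g k + v h l + 1)"
      using that by (simp add: W_def algebra_simps)
    then have "s \<le> v g k + v h l"
      unfolding mult_less_cancel1 by simp
    then have "p ^ s dvd p ^ (v g k) * p ^ (v h l)"
      by (metis le_imp_power_dvd power_add)
    also have "\<dots> dvd coeff g k * coeff h l"
      unfolding v_def by (intro mult_dvd_mono multiplicity_dvd)
    finally show ?thesis .
  next
    case False
    then show ?thesis by (auto simp: supp_def)
  qed
  define s where "s = v g i + v h j"
  (* Every other term of this coefficient uses an exponent beyond i in g or beyond j in h,
     where the weight is strictly larger. *)
  have "\<not> p ^ Suc s dvd coeff (g * h) (i + j)"
  proof
    assume dvd: "p ^ Suc s dvd coeff (g * h) (i + j)"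
    have "p ^ Suc s dvd (\<Sum>k\<in>{..i+j} - {i}. coeff g k * coeff h (i + j - k))"
    proof (intro dvd_sum term_dvd)
      fix k assume k: "k \<in> {..i + j} - {i}" "k \<in> supp g" "i + j - k \<in> supp h"
      have "W g i + W h j < W g k + W h (i + j - k)"
        using i(2,3)[OF k(2)] j(2,3)[OF k(3)] k(1)
        by (cases "i < k") (auto intro: add_less_le_mono add_le_less_mono)
      moreover have "W g i + W h j = m * s + (i + j) * u"
        by (simp add: W_def s_def algebra_simps)
      ultimately show "m * Suc s + (k + (i + j - k)) * u < W g k + W h (i + j - k) + m"
        using k(1) by simp
    qed
    then have "p ^ Suc s dvd coeff g i * coeff h j"
      using dvd by (simp add: coeff_mult sum.remove[of "{..i+j}" i] dvd_add_left_iff del: power_Suc)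
    then have "Suc s \<le> multiplicity p (coeff g i * coeff h j)"
      using i(1) j(1) p_unit by (subst power_dvd_iff_le_multiplicity[symmetric]) (auto simp: supp_def)
    then show False
      using i(1) j(1) prime_elem_multiplicity_mult_distrib[OF pe]
      by (auto simp: supp_def s_def v_def)
  qed
  then have nz: "coeff (g * h) (i + j) \<noteq> 0"
    by auto
  have Ws: "W g i + W h j = m * s + (i + j) * u"
    by (simp add: W_def s_def algebra_simps)
  (* If the minima were attained only at exponent 0, all points of g h other than the one at 0
     would lie strictly above the edge, including the one at m. *)
  have "i + j \<noteq> 0"
  proof
    assume "i + j = 0"
    then have "p ^ 1 dvd coeff (g * h) m"
      unfolding coeff_mult
    proof (intro dvd_sum term_dvd)
      fix k assume k: "k \<in> {..m}" "k \<in> supp g" "m - k \<in> supp h"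
      have "W g i + W h j < W g k + W h (m - k)"
        using i(2,3)[OF k(2)] j(2,3)[OF k(3)] k(1) \<open>i + j = 0\<close> \<open>0 < m\<close>
        by (cases "0 < k") (auto intro: add_less_le_mono add_le_less_mono)
      moreover have "W g i + W h j = m * u"
        using \<open>i + j = 0\<close> mu by (simp add: W_def)
      ultimately show "m * 1 + (k + (m - k)) * u < W g k + W h (m - k) + m"
        using k(1) by simp
    qed
    with vertex show False by simp
  qed
  moreover have "\<not> m < i + j"
  proof
    assume "m < i + j"
    then have "m * u < (i + j) * u"
      using \<open>0 < u\<close> by simp
    then show False
      using Ws le0 mu by linarith
  qed
  ultimately have ij: "i + j = m"
    using nz gap[of "i + j"] by force
  have eqs: "m * v g i + i * u = m * v g 0" "m * v h j + j * u = m * v h 0"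
  proof -
    have "m * u \<le> W g i + W h j"
      using Ws ij by simp
    then show "m * v g i + i * u = m * v g 0" "m * v h j + j * u = m * v h 0"
      using le0 mu unfolding W_def by linarith+
  qed
  (* A factor whose edge has length 0 leaves the full drop u of the valuation to the other one. *)
  have "m dvd i * u"
    by (metis eqs(1) dvd_add_right_iff dvd_triv_left)
  then have "m dvd i"
    using cop by (metis coprime_commute coprime_dvd_mult_left_iff)
  then consider "i = 0" | "i = m"
    using ij by (metis dvd_imp_le le_add1 le_antisym neq0_conv)
  then have "v g 0 = 0 \<or> v h 0 = 0"
  proof cases
    case 1
    then have "m * u \<le> m * v h 0"
      using ij eqs(2) by (metis add_0 le_add2)
    then show ?thesis
      using v0 \<open>0 < m\<close> by simp
  next
    case 2
    then have "m * u \<le> m * v g 0"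
      using eqs(1) by (metis le_add2)
    then show ?thesis
      using v0 \<open>0 < m\<close> by simp
  qed
  then show ?thesis
    unfolding v_def using g0 h0 p_unit by (auto simp: multiplicity_eq_zero_iff)
qed

section \<open>Roots outside the unit disc\<close>

lemma of_int_poly_mult:
  "map_poly of_int (g * h) = (map_poly of_int g * map_poly of_int h :: complex poly)"
  by (rule poly_eqI) (simp add: coeff_map_poly coeff_mult)

text \<open>The constant term is, up to sign, the leading coefficient times the product of all roots.\<close>
lemma constant_term_gt_1_if_roots_outside_unit_disc:
  fixes g :: "int poly"
  assumes deg: "0 < degree g"
    and roots: "\<And>z :: complex. norm z \<le> 1 \<Longrightarrow> poly (map_poly of_int g) z \<noteq> 0"
  shows "1 < \<bar>coeff g 0\<bar>"
proof -
  define G where "G = (map_poly of_int g :: complex poly)"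
  have lead: "lead_coeff G = of_int (lead_coeff g)" and degG: "degree G = degree g"
    using deg by (auto simp: G_def coeff_map_poly degree_map_poly)
  obtain root where root: "smult (lead_coeff G) (\<Prod>i<degree G. [:- root i, 1:]) = G"
    by (rule complex_poly_decompose')
  have far: "1 < norm (root i)" if "i < degree G" for i
  proof -
    have "poly (smult (lead_coeff G) (\<Prod>i<degree G. [:- root i, 1:])) (root i) = 0"
      using that by (auto simp: poly_prod)
    then have "poly G (root i) = 0"
      unfolding root .
    then show ?thesis
      using roots[of "root i"] unfolding G_def by force
  qed
  have "norm (\<Prod>i<degree G. root i) > 1"
    unfolding prod_norm[symmetric]
    using deg degG far by (intro less_1_prod) auto
  moreover have "1 \<le> \<bar>lead_coeff g\<bar>"
    using deg by (metis degree_0 leading_coeff_0_iff less_irrefl int_one_le_iff_zero_less zero_less_abs_iff)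
  then have "1 \<le> norm (lead_coeff G)"
    unfolding lead by (simp flip: of_int_abs)
  ultimately have "1 < norm (lead_coeff G) * norm (\<Prod>i<degree G. root i)"
    by (metis less_le_trans mult_le_cancel_right1 norm_ge_zero not_less order_less_imp_le)
  also have "\<dots> = norm (poly (smult (lead_coeff G) (\<Prod>i<degree G. [:- root i, 1:])) 0)"
    by (simp add: poly_prod norm_mult norm_minus_cancel flip: prod_norm)
  also have "\<dots> = norm (coeff G 0)"
    unfolding root by (simp add: poly_0_coeff_0)
  also have "\<dots> = \<bar>of_int (coeff g 0)\<bar>"
    by (simp add: G_def coeff_map_poly)
  finally show ?thesis by linarith
qed

text \<open>
  The Newton polygon makes the constant term of one factor prime to \<open>p\<close>, hence equal to \<open>\<plusminus>1\<close>; the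
  position of the roots leaves no room for such a factor other than the constants \<open>\<plusminus>1\<close>.
  This also covers constant factors, so primitivity of \<open>f\<close> comes out as a by-product.
\<close>
lemma irreducible_if_newton_edge_and_roots_outside_unit_disc:
  fixes f :: "int poly" and p :: int
  assumes p: "prime p"
    and const: "\<bar>coeff f 0\<bar> = p ^ u"
    and gap: "\<And>k. 0 < k \<Longrightarrow> k < m \<Longrightarrow> coeff f k = 0"
    and vertex: "\<not> p dvd coeff f m"
    and "coprime u m" "0 < u" "0 < m"
    and roots: "\<And>z :: complex. norm z \<le> 1 \<Longrightarrow> poly (map_poly of_int f) z \<noteq> 0"
  shows "irreducible f"
proof -
  have unit: "is_unit g" if "f = g * h" "\<not> p dvd coeff g 0" for g h
  proof -
    have "coeff g 0 dvd coeff f 0"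
      by (simp add: that(1) coeff_mult_0)
    then have "coeff g 0 dvd p ^ u"
      by (metis const dvd_abs_iff)
    moreover have "coprime (coeff g 0) (p ^ u)"
      using prime_imp_coprime[OF p that(2)] by (simp add: coprime_commute)
    ultimately have unit0: "is_unit (coeff g 0)"
      by (metis coprime_absorb_left)
    have "degree g = 0"
    proof (rule ccontr)
      assume "degree g \<noteq> 0"
      then have "1 < \<bar>coeff g 0\<bar>"
        using roots
        by (intro constant_term_gt_1_if_roots_outside_unit_disc) (auto simp: that(1) of_int_poly_mult)
      then show False
        using unit0 by simp
    qed
    then have "g = [:coeff g 0:]"
      by (metis degree_eq_zeroE coeff_pCons_0)
    then show ?thesis
      by (metis unit0 is_unit_const_poly_iff)
  qed
  have "coeff f m \<noteq> 0"
    using vertex by auto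
  then have "\<not> is_unit f" "f \<noteq> 0"
    using \<open>0 < m\<close> by (auto simp: is_unit_poly_iff coeff_pCons split: nat.splits)
  moreover have "is_unit g \<or> is_unit h" if "f = g * h" for g h
    using newton_polygon_one_edge_factor[OF p, of g h u m] assms unit[of g h] unit[of h g] that
    by (auto simp: mult.commute)
  ultimately show ?thesis
    by (intro irreducibleI) auto
qed

text \<open>
  The real part of the sum is \<open>\<Sum> a\<^sub>i (Re (z^n\<^sub>i) + 1)\<close>, in which no term is negative; hence every
  \<open>z^n\<^sub>i\<close> has real part \<open>-1\<close>, and \<open>-1\<close> is the only point of the closed unit disc with this property.
\<close>
lemma powers_eq_minus_1_if_weighted_sum_extremal:
  fixes a :: "'b \<Rightarrow> real" and z :: complex
  assumes "finite I" and pos: "\<And>i. i \<in> I \<Longrightarrow> 0 < a i"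
    and z: "norm z \<le> 1"
    and sum: "(\<Sum>i\<in>I. of_real (a i) * z ^ n i) + of_real (\<Sum>i\<in>I. a i) = 0"
    and "i \<in> I"
  shows "z ^ n i = -1"
proof -
  have norm: "norm (z ^ k) \<le> 1" for k
    using z by (simp add: norm_power power_le_one)
  have nonneg: "0 \<le> a j * (Re (z ^ n j) + 1)" if "j \<in> I" for j
    using pos[OF that] abs_Re_le_cmod[of "z ^ n j"] norm[of "n j"] by (intro mult_nonneg_nonneg) auto
  have "(\<Sum>j\<in>I. a j * (Re (z ^ n j) + 1)) = Re ((\<Sum>i\<in>I. of_real (a i) * z ^ n i) + of_real (\<Sum>i\<in>I. a i))"
    by (simp add: algebra_simps sum.distrib)
  also have "\<dots> = 0"
    unfolding sum by simp
  finally have "a i * (Re (z ^ n i) + 1) = 0"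
    using sum_nonneg_eq_0_iff[of I "\<lambda>j. a j * (Re (z ^ n j) + 1)"] nonneg assms(1) \<open>i \<in> I\<close> by auto
  then have re: "Re (z ^ n i) = -1"
    using pos[OF \<open>i \<in> I\<close>] by auto
  have "(Re (z ^ n i))\<^sup>2 + (Im (z ^ n i))\<^sup>2 \<le> 1"
    using norm[of "n i"] by (simp add: cmod_def)
  then have "Im (z ^ n i) = 0"
    using re by simp
  with re show ?thesis
    by (simp add: complex_eq_iff)
qed

section \<open>Exponents and their powers of two\<close>

lemma e_odd_part:
  assumes "0 < k"
  obtains q where "e k * q = k" "odd q"
proof -
  obtain q where "k = 2 ^ multiplicity 2 k * q" "\<not> 2 dvd q"
    by (rule multiplicity_decompose'[of k 2]) (use assms in auto)
  then show ?thesis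
    by (intro that[of q]) (auto simp: e_def)
qed

text \<open>
  If \<open>k\<close> contained fewer factors \<open>2\<close> than \<open>l\<close>, some even multiple of \<open>k\<close> would be an odd
  multiple of \<open>l\<close>, and \<open>z\<close> to this common multiple would be both \<open>1\<close> and \<open>-1\<close>.
\<close>
lemma e_eq_if_powers_eq_minus_1:
  fixes z :: "'b :: {field_char_0}"
  assumes "z ^ k = -1" "z ^ l = -1" "0 < k" "0 < l"
  shows "e k = e l"
proof -
  have not_less: "\<not> multiplicity 2 k < multiplicity (2::nat) l"
    if *: "z ^ k = -1" "z ^ l = -1" "0 < k" "0 < l" for k l :: nat
  proof
    assume less: "multiplicity 2 k < multiplicity (2::nat) l"
    obtain q where q: "e k * q = k" "odd q" using e_odd_part *(3) .
    obtain q' where q': "e l * q' = l" "odd q'" using e_odd_part *(4) .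
    obtain c where c: "e l = e k * (2 * c)"
      unfolding e_def using less
      by (metis Suc_leI le_imp_power_dvd dvdE power_Suc2 mult.assoc)
    have "k * (2 * c * q') = e k * q * (2 * c * q')"
      by (simp only: q(1))
    also have "\<dots> = e k * (2 * c) * q' * q"
      by (simp only: ac_simps)
    also have "\<dots> = l * q"
      by (simp only: c[symmetric] q'(1))
    finally have "k * (2 * c * q') = l * q" .
    then have "(z ^ k) ^ (2 * c * q') = (z ^ l) ^ q"
      by (simp flip: power_mult)
    then show False
      using * q(2) by (simp add: power_mult)
  qed
  from not_less[OF assms] not_less[OF assms(2,1,4,3)] show ?thesis
    unfolding e_def by simp
qed

text \<open>For odd \<open>q\<close> the divisibility of \<open>y^q - (-1)^q\<close> by \<open>y - (-1)\<close>, with \<open>y = x^k\<close>.\<close>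
lemma monom_plus_1_dvd_odd_multiple:
  fixes q k :: nat
  assumes "odd q"
  shows "monom (1::int) k + 1 dvd monom 1 (k * q) + 1"
proof -
  have "monom (1::int) k - (-1) dvd monom 1 k ^ q - (-1) ^ q"
    unfolding power_diff_sumr2 by (rule dvd_triv_left)
  then show ?thesis
    using assms by (simp add: monom_power)
qed

section \<open>The irreducibility criterion\<close>

lemma S_form_coeff:
  assumes "S_form p r n a u \<epsilon> f"
  shows "coeff f 0 = int p ^ u * \<epsilon>"
    and "i \<in> {1..r} \<Longrightarrow> 0 < n i"
    and "i \<in> {1..r} \<Longrightarrow> coeff f (n i) = a i"
    and "0 < k \<Longrightarrow> k < n 1 \<Longrightarrow> coeff f k = 0"
proof -
  have f: "f = (\<Sum>i=1..r. monom (a i) (n i)) + [:int p ^ u * \<epsilon>:]"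
    and mono: "strict_mono_on {1..r} n" and n1: "0 < n 1" and r: "1 \<in> {1..r}"
    using assms by (auto simp: S_form_def)
  have ge: "n 1 \<le> n i" if "i \<in> {1..r}" for i
    using strict_mono_on_leD[OF mono r that] that by simp
  then show pos: "0 < n i" if "i \<in> {1..r}" for i
    using that n1 by fastforce
  have inj: "n i = n j \<longleftrightarrow> i = j" if "i \<in> {1..r}" "j \<in> {1..r}" for i j
    using strict_mono_on_eqD[OF mono] that by blast
  have coeff: "coeff f k = (\<Sum>i=1..r. if n i = k then a i else 0) + (if k = 0 then int p ^ u * \<epsilon> else 0)" for k
    unfolding f by (auto simp: coeff_sum coeff_pCons split: nat.splits)
  have "(\<Sum>i=1..r. if n i = 0 then a i else 0) = 0"
    using pos by (intro sum.neutral) fastforce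
  then show "coeff f 0 = int p ^ u * \<epsilon>"
    using coeff[of 0] by simp
  have "(\<Sum>j=1..r. if n j = n i then a j else 0) = (\<Sum>j=1..r. if j = i then a j else 0)" if "i \<in> {1..r}" for i
    using inj that by (intro sum.cong) auto
  then show "coeff f (n i) = a i" if "i \<in> {1..r}" for i
    using that pos[OF that] by (simp add: coeff)
  assume k: "0 < k" "k < n 1"
  have "(\<Sum>i=1..r. if n i = k then a i else 0) = 0"
    using ge k by (intro sum.neutral) fastforce
  then show "coeff f k = 0"
    using coeff[of k] k by simp
qed

theorem corollary8:
  fixes p r u :: nat and n :: "nat \<Rightarrow> nat" and a :: "nat \<Rightarrow> int" and \<epsilon> :: int
    and f :: "int poly"
  assumes "prime p"
    and "S_form p r n a u \<epsilon> f"
    and "f \<in> (S p 1 \<union> S' p 2 \<union> S' p 3) \<inter> positive_polys"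
    and "(\<Sum>i=1..r. a i) = int p ^ u"
  shows "irreducible f \<longleftrightarrow> (\<exists>i\<in>{1..r}. \<exists>j\<in>{1..r}. i \<noteq> j \<and> e (n i) \<noteq> e (n j))"
proof -
  note coeffs = S_form_coeff[OF assms(2)]
  have p: "prime (int p)"
    using assms(1) by simp
  have f: "f = (\<Sum>i=1..r. monom (a i) (n i)) + [:int p ^ u * \<epsilon>:]"
    and r: "1 \<in> {1..r}" and u: "2 \<le> u" and eps: "\<epsilon> = 1 \<or> \<epsilon> = -1"
    and nz: "\<And>i. i \<in> {1..r} \<Longrightarrow> a i \<noteq> 0"
    using assms(2) by (auto simp: S_form_def)
  have pos: "0 < coeff f k" if "coeff f k \<noteq> 0" for k
    using assms(3) that by (auto simp: positive_polys_def)
  have a_pos: "0 < a i" if "i \<in> {1..r}" for i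
    using pos[of "n i"] nz[OF that] coeffs(3)[OF that] by simp
  have "0 < p"
    using assms(1) by (rule prime_gt_0_nat)
  then have "\<epsilon> = 1"
    using eps pos[of 0] coeffs(1) by auto
  have const: "[:int p ^ u * \<epsilon>:] = (\<Sum>i=1..r. [:a i:])"
    using \<open>\<epsilon> = 1\<close> assms(4)
    by (intro poly_eqI) (auto simp: coeff_sum coeff_pCons split: nat.splits)
  show ?thesis
  proof
    assume "\<exists>i\<in>{1..r}. \<exists>j\<in>{1..r}. i \<noteq> j \<and> e (n i) \<noteq> e (n j)"
    then obtain i j where ij: "i \<in> {1..r}" "j \<in> {1..r}" "e (n i) \<noteq> e (n j)"
      by blast
    have roots: "poly (map_poly of_int f) z \<noteq> 0" if z: "norm z \<le> 1" for z :: complex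
    proof
      have "map_poly of_int f = (\<Sum>i=1..r. monom (of_int (a i)) (n i)) + [:of_int (\<Sum>i=1..r. a i) :: complex:]"
        unfolding f assms(4) \<open>\<epsilon> = 1\<close>
        by (rule poly_eqI) (auto simp: coeff_map_poly coeff_sum coeff_pCons split: nat.splits intro: sum.cong)
      moreover assume "poly (map_poly of_int f) z = 0"
      ultimately have sum: "(\<Sum>i=1..r. of_real (real_of_int (a i)) * z ^ n i) + of_real (\<Sum>i=1..r. real_of_int (a i)) = 0"
        by (simp add: poly_sum poly_monom)
      have "z ^ n k = -1" if "k \<in> {1..r}" for k
        by (rule powers_eq_minus_1_if_weighted_sum_extremal[OF _ _ z sum that]) (use a_pos in auto)
      then show False
        using ij e_eq_if_powers_eq_minus_1 coeffs(2) by metis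
    qed
    (* Membership in the union supplies its own representation of f. It is used for the Newton
       polygon instead of being identified with the given one: the criterion only looks at
       coefficients of f. *)
    obtain r' n' a' u' \<epsilon>' where form': "S_form p r' n' a' u' \<epsilon>' f" and "0 < n' 1" "coprime u' (n' 1)"
    proof -
      have "\<exists>r' n' a' u' \<epsilon>' m. S_form p r' n' a' u' \<epsilon>' f \<and> n' 1 = m \<and> (m = 1 \<or> m \<in> {2, 3} \<and> \<not> m dvd u')"
        using assms(3) unfolding S_def S'_def cong_0_iff by blast
      moreover have "coprime x y" if "y = 1 \<or> y \<in> {2, 3} \<and> \<not> y dvd x" for x y :: nat
        using that prime_imp_coprime[of y x] by (auto simp: coprime_commute)
      ultimately show ?thesis
        using that by force
    qed
    note coeffs' = S_form_coeff[OF form']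
    have "1 \<in> {1..r'}" "\<not> int p dvd a' 1" "0 < u'" "\<bar>\<epsilon>'\<bar> = 1"
      using form' by (auto simp: S_form_def)
    then show "irreducible f"
      using coeffs' \<open>0 < n' 1\<close> \<open>coprime u' (n' 1)\<close> roots
      by (intro irreducible_if_newton_edge_and_roots_outside_unit_disc[OF p, of f u' "n' 1"])
        (auto simp: abs_mult)
  next
    assume irr: "irreducible f"
    show "\<exists>i\<in>{1..r}. \<exists>j\<in>{1..r}. i \<noteq> j \<and> e (n i) \<noteq> e (n j)"
    proof (rule ccontr)
      assume "\<not> ?thesis"
      then have same: "e (n i) = e (n 1)" if "i \<in> {1..r}" for i
        using that r by metis
      define E where "E = e (n 1)"
      have "0 < E"
        by (simp add: E_def e_def)
      have "f = (\<Sum>i=1..r. [:a i:] * (monom 1 (n i) + 1))"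
        unfolding f const by (simp add: sum.distrib smult_monom distrib_left)
      moreover have "monom 1 E + 1 dvd monom (1::int) (n i) + 1" if "i \<in> {1..r}" for i
        using e_odd_part[OF coeffs(2)[OF that]] monom_plus_1_dvd_odd_multiple same[OF that]
        unfolding E_def by metis
      ultimately have "monom 1 E + 1 dvd f"
        by (auto intro!: dvd_sum dvd_smult)
      then obtain g where g: "f = (monom 1 E + 1) * g" ..
      have "coeff (monom 1 E + 1 :: int poly) E = 1"
        using \<open>0 < E\<close> by auto
      then have "\<not> is_unit (monom 1 E + 1 :: int poly)"
        using \<open>0 < E\<close> by (metis is_unit_polyE degree_pCons_0 coeff_eq_0 zero_neq_one)
      then have "is_unit g"
        using irr g irreducibleD by blast
      then obtain c where c: "g = [:c:]" "is_unit c"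
        by (auto simp: is_unit_poly_iff)
      have "coeff f 0 = c"
        using \<open>0 < E\<close> by (simp add: g c(1) coeff_mult_0)
      then have "int p ^ u dvd 1"
        using c(2) coeffs(1) \<open>\<epsilon> = 1\<close> by simp
      then show False
        using p u by (simp add: is_unit_power_iff)
    qed
  qed
qed

end
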